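(* Let $G$ be a finite simple graph. Then $G$ is a forest if and only if the following holds: for every system $\mathcal A=(A_e)_{e\in E(G)}$ on $G$ and every multiplicity function $q:E(G)\to\mathbb Z_{>0}$, if $$\nu\Bigl(\bigcup_{e\in F}E(A_e)\Bigr)\ge\sum_{e\in F}q(e)\qquad\text{for every }F\subseteq E(G),$$ then $\mathcal A$ admits a $q$-SDR.
   Context: A system on a finite simple graph $G$ consists of the following data. There is a finite set $U$ of resources, and each $x\in U$ is assigned a (nonempty) connected subgraph $Q_x$ of $G$, its support. For $t\in V(G)$ put $P_t:=\{x\in U: t\in V(Q_x)\}$. The system is a family $\mathcal A=(A_e)_{e\in E(G)}$ such that for every edge $e=tu$ of $G$, $A_e$ is a hypergraph with vertex set $U$ satisfying: (i) the loops (singleton hyperedges) of $A_e$ are exactly the sets $\{x\}$ with $x\in P_t\cap P_u$; (ii) every nonloop hyperedge of $A_e$ is a two-element set of the form $\{x,y\}$ with $x\in P_t$ and $y\in P_u$ (not every such pair need be a hyperedge). A $q$-SDR for $\mathcal A$ chooses, for every $e\in E(G)$, $q(e)$ hyperedges of $A_e$, such that all chosen hyperedges (over all $e$) are pairwise vertex disjoint. A matching in a hypergraph is a set of pairwise disjoint hyperedges (loops count as singleton hyperedges); $\nu$ denotes the maximum size of a matching, and $\nu(\bigcup_{e\in F}E(A_e))$ is the matching number of the hypergraph on $U$ with hyperedge set $\bigcup_{e\in F}E(A_e)$. *)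

theory Defs
  imports Main "HOL-Library.Disjoint_Sets"
begin

section \<open>Finite simple graphs\<close>

text \<open>
  A graph is given by its vertex set and its set of undirected edges, an edge being a
  two-element set of vertices.
\<close>

definition simple_graph :: "'v set \<Rightarrow> 'v set set \<Rightarrow> bool" where
  "simple_graph V E \<longleftrightarrow> finite V \<and> (\<forall>e\<in>E. e \<subseteq> V \<and> card e = 2)"

definition subgraph :: "'v set \<Rightarrow> 'v set set \<Rightarrow> 'v set \<Rightarrow> 'v set set \<Rightarrow> bool" where
  "subgraph W D V E \<longleftrightarrow> W \<subseteq> V \<and> D \<subseteq> E \<and> (\<forall>e\<in>D. e \<subseteq> W)"

definition walk :: "'v set \<Rightarrow> 'v set set \<Rightarrow> 'v list \<Rightarrow> bool" where
  "walk V E p \<longleftrightarrow> p \<noteq> [] \<and> set p \<subseteq> V \<and> successively (\<lambda>u v. {u, v} \<in> E) p"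

definition connected_graph :: "'v set \<Rightarrow> 'v set set \<Rightarrow> bool" where
  "connected_graph V E \<longleftrightarrow>
     V \<noteq> {} \<and> (\<forall>u\<in>V. \<forall>v\<in>V. \<exists>p. walk V E p \<and> hd p = u \<and> last p = v)"

text \<open>A cycle is listed without repeating its first vertex at the end.\<close>

definition graph_cycle :: "'v set \<Rightarrow> 'v set set \<Rightarrow> 'v list \<Rightarrow> bool" where
  "graph_cycle V E p \<longleftrightarrow>
     walk V E p \<and> distinct p \<and> length p \<ge> 3 \<and> {last p, hd p} \<in> E"

definition forest :: "'v set \<Rightarrow> 'v set set \<Rightarrow> bool" where
  "forest V E \<longleftrightarrow> (\<nexists>p. graph_cycle V E p)"


section \<open>Hypergraphs and matchings\<close>

text \<open>A hypergraph is represented by its set of hyperedges; loops are singleton hyperedges.\<close>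

definition matching :: "'r set set \<Rightarrow> 'r set set \<Rightarrow> bool" where
  "matching H M \<longleftrightarrow> M \<subseteq> H \<and> disjoint M"

text \<open>The maximum is meaningful for finite \<open>H\<close>, which is the only case that occurs below.\<close>

definition matching_number :: "'r set set \<Rightarrow> nat" where
  "matching_number H = Max (card ` {M. matching H M})"


section \<open>Systems on a graph\<close>

text \<open>
  The support of the resource \<open>x\<close> is the pair \<open>Q x\<close> of its vertex set and its edge set.
\<close>

definition present :: "'r set \<Rightarrow> ('r \<Rightarrow> 'v set \<times> 'v set set) \<Rightarrow> 'v \<Rightarrow> 'r set" where
  "present U Q t = {x\<in>U. t \<in> fst (Q x)}"

text \<open>
  Both conditions on \<open>A {t, u}\<close> are symmetric in \<open>t\<close> and \<open>u\<close>, so it does not matter that the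
  quantification below runs over both orientations of every edge.
\<close>

definition graph_system ::
  "'v set \<Rightarrow> 'v set set \<Rightarrow> 'r set \<Rightarrow> ('r \<Rightarrow> 'v set \<times> 'v set set) \<Rightarrow>
   ('v set \<Rightarrow> 'r set set) \<Rightarrow> bool" where
  "graph_system V E U Q A \<longleftrightarrow>
     finite U \<and>
     (\<forall>x\<in>U. subgraph (fst (Q x)) (snd (Q x)) V E \<and>
             connected_graph (fst (Q x)) (snd (Q x))) \<and>
     (\<forall>t u. {t, u} \<in> E \<longrightarrow>
        (\<forall>h\<in>A {t, u}. h \<subseteq> U) \<and>
        {h\<in>A {t, u}. is_singleton h} = (\<lambda>x. {x}) ` (present U Q t \<inter> present U Q u) \<and>
        (\<forall>h\<in>A {t, u}. \<not> is_singleton h \<longrightarrow>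
           (\<exists>x y. x \<in> present U Q t \<and> y \<in> present U Q u \<and> x \<noteq> y \<and> h = {x, y})))"

text \<open>
  \<open>S e\<close> is the set of hyperedges chosen for the edge \<open>e\<close>.  Disjointness is required of the pairs
  \<open>(e, h)\<close> with \<open>h \<in> S e\<close>, so that the same hyperedge cannot be chosen for two different edges.
\<close>

definition is_q_SDR ::
  "'v set set \<Rightarrow> ('v set \<Rightarrow> 'r set set) \<Rightarrow> ('v set \<Rightarrow> nat) \<Rightarrow> ('v set \<Rightarrow> 'r set set) \<Rightarrow> bool" where
  "is_q_SDR E A q S \<longleftrightarrow>
     (\<forall>e\<in>E. S e \<subseteq> A e \<and> card (S e) = q e) \<and>
     pairwise (\<lambda>(e, h) (f, k). disjnt h k) (Sigma E S)"

definition has_q_SDR ::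
  "'v set set \<Rightarrow> ('v set \<Rightarrow> 'r set set) \<Rightarrow> ('v set \<Rightarrow> nat) \<Rightarrow> bool" where
  "has_q_SDR E A q \<longleftrightarrow> (\<exists>S. is_q_SDR E A q S)"

end

theory Submission
  imports Defs
begin

text \<open>
  \<^bold>\<open>Forests have the property.\<close>  Matching numbers are replaced by vertex covers, which can be
  rounded: if \<open>C\<close> meets every hyperedge of \<open>\<Union>e\<in>F. A e\<close>, then \<open>card C\<close> is at least the matching
  number and hence at least \<open>sum q F\<close>.  A family in which all covers \<open>C\<close> of all \<open>F\<close> satisfy
  \<open>sum q F \<le> card C\<close> is called ample, and it is shown that ample families on a forest are solvable.

  The key is the uncrossing of two covers \<open>C1\<close> of \<open>F1\<close> and \<open>C2\<close> of \<open>F2\<close> (lemma \<open>uncross\<close>).  Imagine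
  two levels, and suppose that an edge lies in as many levels as there are sets among \<open>F1\<close>, \<open>F2\<close>
  containing it; likewise for a resource and \<open>C1\<close>, \<open>C2\<close>.  Every vertex of \<open>G\<close> gets a preferred level
  \<open>\<sigma> v\<close>, which changes along the edges of \<open>F1 \<inter> F2\<close> and along no other edge.  Such a \<open>\<sigma>\<close>
  exists because \<open>G\<close> is a forest (lemma \<open>forest_flippable\<close>).  An edge that occurs once goes to the
  level preferred by its ends; a resource that occurs once goes to the level preferred on its
  support, where \<open>\<sigma>\<close> is constant: if an edge of \<open>F1 \<inter> F2\<close> had both its ends in the support, the
  resource would have a loop there and would belong to \<open>C1 \<inter> C2\<close>.  For a nonloop hyperedge
  \<open>{x, y}\<close> of an edge \<open>e\<close> with \<open>x\<close> and \<open>y\<close> occurring once each, the flip of \<open>\<sigma>\<close> along \<open>e\<close> puts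
  \<open>x\<close> and \<open>y\<close> in different levels exactly when both levels contain \<open>e\<close>.  So both levels are
  covers again, and if the two given covers miss few hyperedges, it is known which level misses them.

  With this tool the nonloop hyperedges are eliminated one at a time (lemma \<open>ample_solvable\<close>).  A
  hyperedge whose deletion leaves the family ample is deleted.  If there is none, then each hyperedge
  \<open>h\<close> has a set \<open>F\<close> and a set of fewer than \<open>sum q F\<close> resources that covers everything in \<open>F\<close>
  except \<open>h\<close>.  If two hyperedges \<open>h\<close>, \<open>k\<close> share a resource \<open>z\<close>, uncrossing the two sets puts both
  defects into the same level, where \<open>z\<close> repairs both of them at once; this contradicts ampleness.
  Hence the nonloop hyperedges are pairwise disjoint, and one of them, \<open>{x, y}\<close> at \<open>e\<close>, can be
  contracted: \<open>x\<close> and \<open>y\<close> become a single resource whose support is the union of their supports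
  joined by \<open>e\<close>.  A second uncrossing shows that the contracted family is ample (lemma
  \<open>merge_ample\<close>).  When only loops remain, Hall's marriage theorem finishes the proof.

  \<^bold>\<open>Graphs with a cycle do not.\<close>  Choose three edges \<open>a = {v0, v1}\<close>, \<open>b = {v1, v2}\<close> and
  \<open>c = {vn, v0}\<close> of the cycle and let \<open>R\<close> be the path from \<open>v2\<close> to \<open>vn\<close>.  Five resources with supports
  \<open>R + v0\<close>, \<open>R + v1\<close>, \<open>R\<close>, \<open>v0\<close>, \<open>v1\<close> compete for \<open>a\<close>, \<open>b\<close>, \<open>c\<close>, while every other edge has a
  private resource.  The only hyperedge for \<open>a\<close> destroys the loops at \<open>b\<close> and \<open>c\<close>, and the remaining
  hyperedges for \<open>b\<close> and \<open>c\<close> meet in the resource supported on \<open>R\<close>.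
\<close>

section \<open>Hall's marriage theorem\<close>

text \<open>
  The classical dichotomy: either some nonempty proper subfamily is tight, and the problem splits
  into that subfamily and the rest, or every one has a spare element, and one choice is made freely.
\<close>

lemma marriage:
  assumes "finite D" and "\<And>d. d \<in> D \<Longrightarrow> finite (N d)"
    and "\<And>D'. D' \<subseteq> D \<Longrightarrow> card D' \<le> card (\<Union>(N ` D'))"
  shows "\<exists>g. inj_on g D \<and> (\<forall>d\<in>D. g d \<in> N d)"
  using assms
proof (induction D arbitrary: N rule: finite_psubset_induct)
  case (psubset D)
  note fin = psubset.prems(1) and hall = psubset.prems(2)
  show ?case
  proof (cases "\<exists>D0. D0 \<noteq> {} \<and> D0 \<subset> D \<and> card (\<Union>(N ` D0)) \<le> card D0")
    case True
    then obtain D0 where D0: "D0 \<noteq> {}" "D0 \<subset> D" "card (\<Union>(N ` D0)) \<le> card D0"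
      by blast
    define B where "B = \<Union>(N ` D0)"
    have finD0: "finite D0"
      using D0(2) psubset.hyps finite_subset by blast
    have finB: "finite B"
      unfolding B_def using D0(2) fin finD0 by auto
    have "\<exists>g. inj_on g D0 \<and> (\<forall>d\<in>D0. g d \<in> N d)"
      using D0(2) fin hall by (intro psubset.IH) auto
    then obtain g where g: "inj_on g D0" "\<And>d. d \<in> D0 \<Longrightarrow> g d \<in> N d" by blast
    have "\<exists>g. inj_on g (D - D0) \<and> (\<forall>d\<in>D - D0. g d \<in> N d - B)"
    proof (rule psubset.IH)
      show "D - D0 \<subset> D" using D0 by blast
      show "finite (N d - B)" if "d \<in> D - D0" for d using that fin by auto
      fix X assume X: "X \<subseteq> D - D0"
      have finX: "finite X" using X psubset.hyps finite_subset by blast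
      have "card X + card D0 = card (X \<union> D0)"
        using X finX finD0 by (subst card_Un_disjoint) auto
      also have "\<dots> \<le> card (\<Union>(N ` (X \<union> D0)))"
        using X D0(2) by (intro hall) auto
      also have "\<Union>(N ` (X \<union> D0)) = \<Union>((\<lambda>d. N d - B) ` X) \<union> B"
        unfolding B_def by auto
      also have "card \<dots> \<le> card (\<Union>((\<lambda>d. N d - B) ` X)) + card B"
        by (rule card_Un_le)
      finally show "card X \<le> card (\<Union>((\<lambda>d. N d - B) ` X))"
        using D0(3) unfolding B_def by linarith
    qed
    then obtain g' where g': "inj_on g' (D - D0)" "\<And>d. d \<in> D - D0 \<Longrightarrow> g' d \<in> N d - B"
      by blast
    have gB: "g d \<in> B" if "d \<in> D0" for d using g(2) that unfolding B_def by auto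
    have "inj_on (\<lambda>d. if d \<in> D0 then g d else g' d) D"
      by (rule inj_onI)
        (use g(1) g'(1) gB g'(2) in \<open>force dest: inj_onD split: if_splits\<close>)
    moreover have "\<forall>d\<in>D. (if d \<in> D0 then g d else g' d) \<in> N d"
      using g(2) g'(2) by auto
    ultimately show ?thesis by blast
  next
    case False
    show ?thesis
    proof (cases "D = {}")
      case True
      then show ?thesis by auto
    next
      case False
      then obtain d where d: "d \<in> D" by blast
      have "card {d} \<le> card (\<Union>(N ` {d}))" using d by (intro hall) auto
      then have "N d \<noteq> {}" by auto
      then obtain x where x: "x \<in> N d" by blast
      have "\<exists>g. inj_on g (D - {d}) \<and> (\<forall>k\<in>D - {d}. g k \<in> N k - {x})"
      proof (rule psubset.IH)
        show "D - {d} \<subset> D" using d by blast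
        show "finite (N k - {x})" if "k \<in> D - {d}" for k using that fin by auto
        fix X assume X: "X \<subseteq> D - {d}"
        show "card X \<le> card (\<Union>((\<lambda>k. N k - {x}) ` X))"
        proof (cases "X = {}")
          case False
          have "X \<subset> D" using X d by blast
          then have "card X < card (\<Union>(N ` X))"
            using \<open>\<not> (\<exists>D0. _ D0)\<close> False by (meson not_le)
          moreover have "(\<Union>((\<lambda>k. N k - {x}) ` X)) = \<Union>(N ` X) - {x}" by auto
          ultimately show ?thesis
            by (auto simp: card_Diff_singleton_if)
        qed simp
      qed
      then obtain g where g: "inj_on g (D - {d})" "\<And>k. k \<in> D - {d} \<Longrightarrow> g k \<in> N k - {x}"
        by blast
      have "inj_on (g(d := x)) D"
        by (rule inj_onI) (use g in \<open>force dest: inj_onD split: if_splits\<close>)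
      moreover have "\<forall>k\<in>D. (g(d := x)) k \<in> N k"
        using g(2) x by auto
      ultimately show ?thesis by blast
    qed
  qed
qed

section \<open>Two-colourings of a forest\<close>

lemma rtranclp_distinct_path:
  assumes "R\<^sup>*\<^sup>* u v" and "u \<in> W" and "\<And>a b. R a b \<Longrightarrow> b \<in> W"
  shows "\<exists>p. p \<noteq> [] \<and> distinct p \<and> set p \<subseteq> W \<and> successively R p \<and> hd p = u \<and> last p = v"
  using assms(1)
proof (induction rule: rtranclp_induct)
  case base
  show ?case using assms(2) by (intro exI[of _ "[u]"]) auto
next
  case (step v w)
  then obtain p where p: "p \<noteq> []" "distinct p" "set p \<subseteq> W" "successively R p" "hd p = u" "last p = v"
    by blast
  show ?case
  proof (cases "w \<in> set p")
    case True
    then obtain as bs where "p = as @ w # bs" by (meson split_list)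
    then show ?thesis using p
      by (intro exI[of _ "as @ [w]"]) (auto simp: successively_append_iff hd_append)
  next
    case False
    then show ?thesis using p step.hyps(2) assms(3)
      by (intro exI[of _ "p @ [w]"]) (auto simp: successively_append_iff)
  qed
qed

text \<open>
  The only way in which the absence of cycles enters the proof: a two-colouring of the vertices may
  be prescribed by naming the edges along which the colour changes.
\<close>

definition flippable :: "'v set set \<Rightarrow> bool" where
  "flippable E \<longleftrightarrow>
     (\<forall>J. \<exists>\<sigma> :: 'v \<Rightarrow> bool. \<forall>t u. {t, u} \<in> E \<longrightarrow> (\<sigma> t = \<sigma> u \<longleftrightarrow> {t, u} \<notin> J))"

lemma flippableE:
  assumes "flippable E"
  obtains \<sigma> :: "'v \<Rightarrow> bool"
  where "\<And>t u. {t, u} \<in> E \<Longrightarrow> \<sigma> t = \<sigma> u \<longleftrightarrow> {t, u} \<notin> J"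
  using assms unfolding flippable_def by blast

text \<open>
  Edges are added one at a time.  A new edge joins two different components, since otherwise it would
  close a cycle, and exchanging the colours on one of the two components corrects its behaviour.
\<close>

lemma forest_flippable:
  assumes "simple_graph V E" and "forest V E"
  shows "flippable E"
  unfolding flippable_def
proof
  fix J :: "'a set set"
  have EV: "e \<subseteq> V" "card e = 2" if "e \<in> E" for e
    using assms(1) that unfolding simple_graph_def by auto
  have "finite E"
    using assms(1) EV(1) unfolding simple_graph_def by (meson PowI finite_Pow_iff finite_subset subsetI)
  have "\<exists>\<sigma>. \<forall>t u. {t, u} \<in> D \<longrightarrow> ((\<sigma> t :: bool) = \<sigma> u \<longleftrightarrow> {t, u} \<notin> J)"
    if "finite D" "D \<subseteq> E" for D
    using that
  proof (induction D rule: finite_subset_induct')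
    case empty
    show ?case by auto
  next
    case (insert e D)
    then obtain \<sigma> where \<sigma>: "\<And>t u. {t, u} \<in> D \<Longrightarrow> (\<sigma> t :: bool) = \<sigma> u \<longleftrightarrow> {t, u} \<notin> J"
      by blast
    obtain t u where e: "e = {t, u}" "t \<noteq> u"
      using EV(2)[OF insert.hyps(2)] by (meson card_2_iff)
    define R where "R = (\<lambda>a b. {a, b} \<in> D)\<^sup>*\<^sup>* t"
    have Rstep: "R a \<longleftrightarrow> R b" if "{a, b} \<in> D" for a b
    proof -
      have "(\<lambda>a b. {a, b} \<in> D) a b" "(\<lambda>a b. {a, b} \<in> D) b a"
        using that by (simp_all add: insert_commute)
      then show ?thesis
        unfolding R_def by (blast intro: rtranclp.rtrancl_into_rtrancl)
    qed
    have Rt: "R t" unfolding R_def by simp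
    have Ru: "\<not> R u"
    proof
      assume "R u"
      then have "(\<lambda>a b. {a, b} \<in> D)\<^sup>*\<^sup>* t u" unfolding R_def .
      moreover have "t \<in> V" using EV(1)[OF insert.hyps(2)] e(1) by simp
      moreover have "b \<in> V" if "{a, b} \<in> D" for a b
        using EV(1)[of "{a, b}"] insert.hyps(3) that by auto
      ultimately have "\<exists>p. p \<noteq> [] \<and> distinct p \<and> set p \<subseteq> V \<and>
          successively (\<lambda>a b. {a, b} \<in> D) p \<and> hd p = t \<and> last p = u"
        by (rule rtranclp_distinct_path)
      then obtain p where p: "p \<noteq> []" "distinct p" "set p \<subseteq> V" "successively (\<lambda>a b. {a, b} \<in> D) p"
        "hd p = t" "last p = u"
        by (elim exE conjE) (rule that)
      have "length p \<ge> 3"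
      proof (rule ccontr)
        assume "\<not> length p \<ge> 3"
        then consider a where "p = [a]" | a b where "p = [a, b]"
          using p(1) by (cases p; cases "tl p"; cases "tl (tl p)") auto
        then show False using p(4-6) e insert.hyps(4) by cases auto
      qed
      moreover have "successively (\<lambda>a b. {a, b} \<in> E) p"
        using p(4) by (rule successively_mono) (use insert.hyps(3) in auto)
      ultimately have "graph_cycle V E p"
        using p e insert.hyps(2) unfolding graph_cycle_def walk_def by (auto simp: insert_commute)
      then show False using assms(2) unfolding forest_def by blast
    qed
    \<comment> \<open>Flipping \<open>\<sigma>\<close> on the component of \<open>t\<close> changes the behaviour on \<open>e\<close> only.\<close>
    define flip where "flip \<longleftrightarrow> (\<sigma> t = \<sigma> u \<longleftrightarrow> e \<in> J)"
    define \<sigma>' where "\<sigma>' v = (\<sigma> v \<noteq> (R v \<and> flip))" for v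
    have new: "\<sigma>' t = \<sigma>' u \<longleftrightarrow> e \<notin> J"
      unfolding \<sigma>'_def flip_def using Rt Ru by auto
    have "\<sigma>' a = \<sigma>' b \<longleftrightarrow> {a, b} \<notin> J" if ab: "{a, b} \<in> insert e D" for a b
    proof (cases "{a, b} = e")
      case True
      then show ?thesis using new e by (auto simp: doubleton_eq_iff insert_commute)
    next
      case False
      then show ?thesis
        using ab \<sigma>[of a b] Rstep[of a b] unfolding \<sigma>'_def by auto
    qed
    then show ?case by blast
  qed
  from this[OF \<open>finite E\<close> order_refl]
  show "\<exists>\<sigma>. \<forall>t u. {t, u} \<in> E \<longrightarrow> ((\<sigma> t :: bool) = \<sigma> u \<longleftrightarrow> {t, u} \<notin> J)" .
qed


section \<open>Resources, covers and ample families\<close>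

text \<open>
  Connectedness in the subgraph induced on \<open>S\<close>, phrased through two-colourings because these are
  what supports are tested against.  In this form it passes to the union of two supports joined by
  an edge without any handling of walks.
\<close>

definition tied :: "'v set set \<Rightarrow> 'v set \<Rightarrow> bool" where
  "tied E S \<longleftrightarrow>
     (\<forall>f :: 'v \<Rightarrow> bool. (\<forall>a\<in>S. \<forall>b\<in>S. {a, b} \<in> E \<longrightarrow> f a = f b) \<longrightarrow>
        (\<forall>a\<in>S. \<forall>b\<in>S. f a = f b))"

lemma tiedD:
  fixes f :: "'v \<Rightarrow> bool"
  assumes "tied E S" and "\<And>a b. a \<in> S \<Longrightarrow> b \<in> S \<Longrightarrow> {a, b} \<in> E \<Longrightarrow> f a = f b"
    and "a \<in> S" and "b \<in> S"
  shows "f a = f b"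
  using assms unfolding tied_def by blast

lemma tied_union:
  assumes "tied E S" and "tied E S'" and "{t, u} \<in> E" and "t \<in> S" and "u \<in> S'"
  shows "tied E (S \<union> S')"
  unfolding tied_def
proof (intro allI impI)
  fix f :: "'a \<Rightarrow> bool"
  assume f: "\<forall>a\<in>S \<union> S'. \<forall>b\<in>S \<union> S'. {a, b} \<in> E \<longrightarrow> f a = f b"
  have 1: "f a = f t" if "a \<in> S" for a
    by (rule tiedD[OF assms(1)]) (use f that assms(4) in blast)+
  have 2: "f a = f u" if "a \<in> S'" for a
    by (rule tiedD[OF assms(2)]) (use f that assms(5) in blast)+
  have "f t = f u" using f assms(3-5) by blast
  then show "\<forall>a\<in>S \<union> S'. \<forall>b\<in>S \<union> S'. f a = f b" using 1 2 by (metis UnE)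
qed

lemma connected_graph_tied:
  assumes "connected_graph W D" and "D \<subseteq> E"
  shows "tied E W"
  unfolding tied_def
proof (intro allI impI ballI)
  fix f :: "'a \<Rightarrow> bool" and a b
  assume f: "\<forall>a\<in>W. \<forall>b\<in>W. {a, b} \<in> E \<longrightarrow> f a = f b" and ab: "a \<in> W" "b \<in> W"
  obtain p where p: "p \<noteq> []" "set p \<subseteq> W" "successively (\<lambda>u v. {u, v} \<in> D) p" "hd p = a" "last p = b"
    using assms(1) ab unfolding connected_graph_def walk_def by blast
  have "f (hd p) = f (last p)"
    using p(1-3)
  proof (induction p rule: induct_list012)
    case (3 x y zs)
    then have "f x = f y" using f assms(2) by (metis list.set_intros subsetD successively.simps(3))
    then show ?case using 3 by simp
  qed auto
  then show "f a = f b" using p by simp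
qed

text \<open>
  A token \<open>(t, u, x, y)\<close> is the nonloop hyperedge \<open>{x, y}\<close> of the edge \<open>{t, u}\<close>, with \<open>x\<close> present at
  \<open>t\<close> and \<open>y\<close> present at \<open>u\<close>.  Loops are not listed: \<open>x\<close> has a loop at \<open>e\<close> if and only if \<open>e \<subseteq> T x\<close>,
  where \<open>T x\<close> is the vertex set of the support of \<open>x\<close>.
\<close>

type_synonym ('v, 'r) token = "'v \<times> 'v \<times> 'r \<times> 'r"

definition arrangement ::
  "'v set set \<Rightarrow> 'r set \<Rightarrow> ('r \<Rightarrow> 'v set) \<Rightarrow> ('v, 'r) token set \<Rightarrow> bool" where
  "arrangement E U T P \<longleftrightarrow>
     finite E \<and> (\<forall>e\<in>E. card e = 2) \<and> finite U \<and> finite P \<and> (\<forall>x\<in>U. tied E (T x)) \<and>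
     (\<forall>(t, u, x, y)\<in>P. {t, u} \<in> E \<and> x \<in> U \<and> y \<in> U \<and> t \<in> T x \<and> u \<in> T y)"

lemma arrangement_token:
  assumes "arrangement E U T P" and "(t, u, x, y) \<in> P"
  shows "{t, u} \<in> E" "x \<in> U" "y \<in> U" "t \<in> T x" "u \<in> T y"
  using assms unfolding arrangement_def by auto

lemma arrangement_subset:
  "arrangement E U T P \<Longrightarrow> P' \<subseteq> P \<Longrightarrow> arrangement E U T P'"
  unfolding arrangement_def by (auto intro: finite_subset)

definition covers_loops ::
  "'r set \<Rightarrow> ('r \<Rightarrow> 'v set) \<Rightarrow> 'v set set \<Rightarrow> 'r set \<Rightarrow> bool" where
  "covers_loops U T F C \<longleftrightarrow> (\<forall>x\<in>U. \<forall>e\<in>F. e \<subseteq> T x \<longrightarrow> x \<in> C)"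

fun covers_token :: "'v set set \<Rightarrow> 'r set \<Rightarrow> ('v, 'r) token \<Rightarrow> bool" where
  "covers_token F C (t, u, x, y) \<longleftrightarrow> ({t, u} \<in> F \<longrightarrow> x \<in> C \<or> y \<in> C)"

text \<open>
  Hall's condition with vertex covers instead of matchings.
\<close>

definition ample ::
  "'v set set \<Rightarrow> 'r set \<Rightarrow> ('r \<Rightarrow> 'v set) \<Rightarrow> ('v, 'r) token set \<Rightarrow> ('v set \<Rightarrow> nat) \<Rightarrow> bool" where
  "ample E U T P q \<longleftrightarrow>
     (\<forall>F C. F \<subseteq> E \<longrightarrow> C \<subseteq> U \<longrightarrow> covers_loops U T F C \<longrightarrow> (\<forall>h\<in>P. covers_token F C h) \<longrightarrow>
        sum q F \<le> card C)"

lemma ampleD: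
  assumes "ample E U T P q" and "F \<subseteq> E" and "C \<subseteq> U" and "covers_loops U T F C"
    and "\<And>h. h \<in> P \<Longrightarrow> covers_token F C h"
  shows "sum q F \<le> card C"
  using assms unfolding ample_def by blast

section \<open>Uncrossing two covers\<close>

text \<open>
  The edges \<open>F1\<close>, \<open>F2\<close> and the resources \<open>C1\<close>, \<open>C2\<close> are redistributed to two levels as described at the
  beginning, so that the sums of the demands and of the cardinalities are kept.  The last three
  conclusions concern tokens.  A token covered on both sides is covered in both levels, and the same
  holds if \<open>C1\<close> contains both its resources, even if \<open>C2\<close> misses it.  A token covered on one side at
  least is missed by at most one level, and that level, \<open>m x\<close>, can be read off from either one of its
  resources: if \<open>x\<close> does not occur at all, it is the level preferred on the support of \<open>x\<close>, and if \<open>x\<close>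
  occurs once, it is the level that \<open>x\<close> was not put into.  This is what makes the defects of two
  tokens with a common resource coincide.
\<close>

lemma uncross:
  fixes q :: "'v set \<Rightarrow> nat"
  assumes flip: "flippable E" and arr: "arrangement E U T P"
    and F: "F1 \<subseteq> E" "F2 \<subseteq> E" and C: "C1 \<subseteq> U" "C2 \<subseteq> U"
    and loops: "covers_loops U T F1 C1" "covers_loops U T F2 C2"
  obtains F :: "bool \<Rightarrow> 'v set set" and C :: "bool \<Rightarrow> 'r set" and m :: "'r \<Rightarrow> bool"
  where "\<And>b. F b \<subseteq> E" and "\<And>b. C b \<subseteq> U" and "\<And>b. covers_loops U T (F b) (C b)"
    and "\<And>b. sum q (F b) + sum q (F (\<not> b)) = sum q F1 + sum q F2"
    and "\<And>b. card (C b) + card (C (\<not> b)) = card C1 + card C2"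
    and "\<And>h b. h \<in> P \<Longrightarrow> covers_token F1 C1 h \<Longrightarrow> covers_token F2 C2 h \<Longrightarrow>
          covers_token (F b) (C b) h"
    and "\<And>t u x y b. (t, u, x, y) \<in> P \<Longrightarrow> x \<in> C1 \<Longrightarrow> y \<in> C1 \<Longrightarrow>
          covers_token (F b) (C b) (t, u, x, y)"
    and "\<And>t u x y b. (t, u, x, y) \<in> P \<Longrightarrow>
          covers_token F1 C1 (t, u, x, y) \<or> covers_token F2 C2 (t, u, x, y) \<Longrightarrow>
          \<not> covers_token (F b) (C b) (t, u, x, y) \<Longrightarrow> m x = b \<and> m y = b"
proof -
  have finE: "finite E" and finU: "finite U" using arr unfolding arrangement_def by auto
  obtain \<sigma> :: "'v \<Rightarrow> bool"
    where \<sigma>: "\<And>t u. {t, u} \<in> E \<Longrightarrow> \<sigma> t = \<sigma> u \<longleftrightarrow> {t, u} \<notin> F1 \<inter> F2"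
    using flippableE[OF flip, of "F1 \<inter> F2"] by blast
  define \<rho> where "\<rho> x = \<sigma> (SOME v. v \<in> T x)" for x
  define F where "F b = (F1 \<inter> F2) \<union> {e \<in> F1 \<union> F2. \<exists>v\<in>e. \<sigma> v = b}" for b
  define C where "C b = (C1 \<inter> C2) \<union> {x \<in> C1 \<union> C2. \<rho> x = b}" for b
  define m where "m x \<longleftrightarrow> (if x \<in> C1 \<union> C2 then \<not> \<rho> x else \<rho> x)" for x
  \<comment> \<open>An edge of \<open>F1 \<inter> F2\<close> inside the support would force \<open>x\<close> into both covers.\<close>
  have \<rho>: "\<sigma> v = \<rho> x" if "x \<in> U" "x \<notin> C1 \<inter> C2" "v \<in> T x" for x v
    unfolding \<rho>_def
  proof (rule tiedD[where f = \<sigma> and S = "T x" and E = E])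
    show "tied E (T x)" using arr that(1) unfolding arrangement_def by auto
    show "(SOME v. v \<in> T x) \<in> T x" using that(3) by (rule someI)
    fix a b assume ab: "a \<in> T x" "b \<in> T x" "{a, b} \<in> E"
    then have "{a, b} \<notin> F1 \<inter> F2"
      using loops that(1,2) unfolding covers_loops_def by (metis Int_iff empty_subsetI insert_subset)
    then show "\<sigma> a = \<sigma> b" using \<sigma>[OF ab(3)] by simp
  qed (rule that(3))
  have edge: "\<exists>t u. e = {t, u}" if "e \<in> E" for e
    using arr that unfolding arrangement_def by (meson card_2_iff)
  have Fmem: "{t, u} \<in> F b \<longleftrightarrow> {t, u} \<in> F1 \<inter> F2 \<or> {t, u} \<in> F1 \<union> F2 \<and> \<sigma> t = b"
    if "{t, u} \<in> E" for t u b
    using \<sigma>[OF that] unfolding F_def by auto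
  have Cmem: "x \<in> C b \<longleftrightarrow> x \<in> C1 \<inter> C2 \<or> x \<in> C1 \<union> C2 \<and> \<rho> x = b" for x b
    unfolding C_def by auto
  have FE: "F b \<subseteq> E" for b unfolding F_def using F by auto
  have CU: "C b \<subseteq> U" for b unfolding C_def using C by auto
  show thesis
  proof
    show "F b \<subseteq> E" and "C b \<subseteq> U" for b by (fact FE CU)+
    show "covers_loops U T (F b) (C b)" for b
      unfolding covers_loops_def
    proof (intro ballI impI)
      fix x e assume x: "x \<in> U" "e \<in> F b" "e \<subseteq> T x"
      obtain t u where e: "e = {t, u}" "{t, u} \<in> E" using edge x(2) FE by blast
      then have "{t, u} \<in> F1 \<inter> F2 \<or> {t, u} \<in> F1 \<union> F2 \<and> \<sigma> t = b"
        using Fmem[OF e(2), of b] x(2) by simp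
      moreover have "x \<in> C1" if "{t, u} \<in> F1" using that loops(1) x(1,3) e(1)
        unfolding covers_loops_def by blast
      moreover have "x \<in> C2" if "{t, u} \<in> F2" using that loops(2) x(1,3) e(1)
        unfolding covers_loops_def by blast
      moreover have "\<sigma> t = \<rho> x" if "x \<notin> C1 \<inter> C2" using \<rho>[OF x(1) that] x(3) e(1) by simp
      ultimately show "x \<in> C b" unfolding Cmem by blast
    qed
    have split: "F b \<union> F (\<not> b) = F1 \<union> F2" "F b \<inter> F (\<not> b) = F1 \<inter> F2" for b
    proof -
      have "e \<in> F b \<union> F (\<not> b) \<longleftrightarrow> e \<in> F1 \<union> F2" "e \<in> F b \<inter> F (\<not> b) \<longleftrightarrow> e \<in> F1 \<inter> F2"
        if "e \<in> E" for e
        using edge[OF that] Fmem that by auto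
      then show "F b \<union> F (\<not> b) = F1 \<union> F2" "F b \<inter> F (\<not> b) = F1 \<inter> F2"
        using FE F by blast+
    qed
    have fin: "finite F1" "finite F2" "finite (F b)" for b
      using F FE finE finite_subset by metis+
    show "sum q (F b) + sum q (F (\<not> b)) = sum q F1 + sum q F2" for b
      using sum.union_inter[of "F b" "F (\<not> b)" q] sum.union_inter[of F1 F2 q] fin split by simp
    have finC: "finite C1" "finite C2" "finite (C b)" for b
      using C CU finU finite_subset by metis+
    have splitC: "C b \<union> C (\<not> b) = C1 \<union> C2" "C b \<inter> C (\<not> b) = C1 \<inter> C2" for b
      unfolding C_def by auto
    show "card (C b) + card (C (\<not> b)) = card C1 + card C2" for b
      using card_Un_Int[of "C b" "C (\<not> b)"] card_Un_Int[of C1 C2] finC splitC by simp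
    \<comment> \<open>With these equivalences every claim about a token is propositional.\<close>
    have token: "({t, u} \<in> F b \<longleftrightarrow> {t, u} \<in> F1 \<inter> F2 \<or> {t, u} \<in> F1 \<union> F2 \<and> \<sigma> t = b) \<and>
        (\<sigma> t = \<sigma> u \<longleftrightarrow> {t, u} \<notin> F1 \<inter> F2) \<and>
        (x \<notin> C1 \<inter> C2 \<longrightarrow> \<rho> x = \<sigma> t) \<and> (y \<notin> C1 \<inter> C2 \<longrightarrow> \<rho> y = \<sigma> u)"
      if "(t, u, x, y) \<in> P" for t u x y b
      using arrangement_token[OF arr that] Fmem \<sigma> \<rho>[of x t] \<rho>[of y u] by auto
    show "covers_token (F b) (C b) h"
      if "h \<in> P" "covers_token F1 C1 h" "covers_token F2 C2 h" for h b
    proof (cases h)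
      case (fields t u x y)
      show ?thesis using that token[of t u x y b] unfolding fields covers_token.simps Cmem by auto
    qed
    show "covers_token (F b) (C b) (t, u, x, y)"
      if "(t, u, x, y) \<in> P" "x \<in> C1" "y \<in> C1" for t u x y b
      using that token[of t u x y b] unfolding covers_token.simps Cmem by auto
    show "m x = b \<and> m y = b"
      if "(t, u, x, y) \<in> P"
        "covers_token F1 C1 (t, u, x, y) \<or> covers_token F2 C2 (t, u, x, y)"
        "\<not> covers_token (F b) (C b) (t, u, x, y)" for t u x y b
      using that token[of t u x y b] unfolding covers_token.simps Cmem m_def by auto
  qed
qed

section \<open>Critical tokens\<close>

text \<open>
  The witness that a token cannot be deleted: it covers everything else, so it must miss the token.
\<close>

lemma critical_token:
  assumes "ample E U T P q" and "\<not> ample E U T (P - {(t, u, x, y)}) q" 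
  obtains F C where "F \<subseteq> E" "C \<subseteq> U" "covers_loops U T F C" "card C < sum q F"
    and "\<And>h. h \<in> P \<Longrightarrow> h \<noteq> (t, u, x, y) \<Longrightarrow> covers_token F C h"
    and "{t, u} \<in> F" "x \<notin> C" "y \<notin> C"
proof -
  have "\<exists>F C. F \<subseteq> E \<and> C \<subseteq> U \<and> covers_loops U T F C \<and> card C < sum q F \<and>
      (\<forall>h\<in>P - {(t, u, x, y)}. covers_token F C h)"
    using assms(2) unfolding ample_def by (meson not_le)
  then obtain F C where *: "F \<subseteq> E" "C \<subseteq> U" "covers_loops U T F C" "card C < sum q F"
    "\<And>h. h \<in> P - {(t, u, x, y)} \<Longrightarrow> covers_token F C h"
    by blast
  have "\<not> covers_token F C (t, u, x, y)"
    using ampleD[OF assms(1) *(1-3)] *(4,5) by fastforce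
  then show thesis using * by (intro that[of F C]) auto
qed

text \<open>
  Two witnesses together are short by at least two.  After uncrossing, both defects lie in the level \<open>m z\<close> of
  the common resource \<open>z\<close>, so adding \<open>z\<close> to that one level gives two covers with a total that is
  still too small.
\<close>

lemma critical_tokens_disjoint:
  assumes flip: "flippable E" and arr: "arrangement E U T P" and ample: "ample E U T P q"
    and h: "h \<in> P" "h = (t, u, x, y)" "\<not> ample E U T (P - {h}) q"
    and k: "k \<in> P" "k = (t', u', x', y')" "\<not> ample E U T (P - {k}) q"
    and "h \<noteq> k"
  shows "{x, y} \<inter> {x', y'} = {}"
proof (rule ccontr)
  assume "{x, y} \<inter> {x', y'} \<noteq> {}"
  then obtain z where z: "z \<in> {x, y}" "z \<in> {x', y'}" by blast
  obtain F1 C1 where 1: "F1 \<subseteq> E" "C1 \<subseteq> U" "covers_loops U T F1 C1" "card C1 < sum q F1"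
    "\<And>g. g \<in> P \<Longrightarrow> g \<noteq> h \<Longrightarrow> covers_token F1 C1 g"
    using critical_token[OF ample h(3)[unfolded h(2)]] h(2) by metis
  obtain F2 C2 where 2: "F2 \<subseteq> E" "C2 \<subseteq> U" "covers_loops U T F2 C2" "card C2 < sum q F2"
    "\<And>g. g \<in> P \<Longrightarrow> g \<noteq> k \<Longrightarrow> covers_token F2 C2 g"
    using critical_token[OF ample k(3)[unfolded k(2)]] k(2) by metis
  obtain F C m where *: "\<And>b. F b \<subseteq> E" "\<And>b. C b \<subseteq> U" "\<And>b. covers_loops U T (F b) (C b)"
    "\<And>b. sum q (F b) + sum q (F (\<not> b)) = sum q F1 + sum q F2"
    "\<And>b. card (C b) + card (C (\<not> b)) = card C1 + card C2"
    "\<And>g b. g \<in> P \<Longrightarrow> covers_token F1 C1 g \<Longrightarrow> covers_token F2 C2 g \<Longrightarrow>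
          covers_token (F b) (C b) g"
    "\<And>t u x y b. (t, u, x, y) \<in> P \<Longrightarrow>
          covers_token F1 C1 (t, u, x, y) \<or> covers_token F2 C2 (t, u, x, y) \<Longrightarrow>
          \<not> covers_token (F b) (C b) (t, u, x, y) \<Longrightarrow> (m :: 'b \<Rightarrow> bool) x = b \<and> m y = b"
    by (rule uncross[OF flip arr 1(1) 2(1) 1(2) 2(2) 1(3) 2(3), of q]) blast
  have missed: "(g = h \<or> g = k) \<and> m z = b"
    if "g \<in> P" "\<not> covers_token (F b) (C b) g" for g b
  proof -
    have g: "g = h \<or> g = k" using *(6)[OF that(1)] 1(5)[OF that(1)] 2(5)[OF that(1)] that(2) by blast
    have "covers_token F1 C1 g \<or> covers_token F2 C2 g"
      using 1(5)[OF that(1)] 2(5)[OF that(1)] \<open>h \<noteq> k\<close> by blast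
    then have "m z = b"
      using *(7)[of t u x y b] *(7)[of t' u' x' y' b] g that h(2) k(2) z by auto
    then show ?thesis using g by blast
  qed
  have zU: "z \<in> U" using arrangement_token(2,3)[OF arr h(1)[unfolded h(2)]] z(1) by auto
  have "sum q (F (\<not> m z)) \<le> card (C (\<not> m z))"
    using missed by (intro ampleD[OF ample *(1-3)]) blast
  moreover have "sum q (F (m z)) \<le> card (insert z (C (m z)))"
  proof (rule ampleD[OF ample *(1)])
    show "insert z (C (m z)) \<subseteq> U" using zU *(2) by blast
    show "covers_loops U T (F (m z)) (insert z (C (m z)))"
      using *(3)[of "m z"] unfolding covers_loops_def by auto
    show "covers_token (F (m z)) (insert z (C (m z))) g" if "g \<in> P" for g
      using missed[OF that, of "m z"] z h(2) k(2) by (cases g) auto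
  qed
  moreover have "card (insert z (C (m z))) \<le> Suc (card (C (m z)))"
    by (rule card_insert_le_m1) simp_all
  ultimately show False
    using *(4,5)[of "m z"] 1(4) 2(4) by linarith
qed


section \<open>Solutions and the case without tokens\<close>

definition hyperedges ::
  "'r set \<Rightarrow> ('r \<Rightarrow> 'v set) \<Rightarrow> ('v, 'r) token set \<Rightarrow> 'v set \<Rightarrow> 'r set set" where
  "hyperedges U T P e =
     {{x} | x. x \<in> U \<and> e \<subseteq> T x} \<union> {{x, y} | x y t u. (t, u, x, y) \<in> P \<and> {t, u} = e}"

definition demands :: "'v set set \<Rightarrow> ('v set \<Rightarrow> nat) \<Rightarrow> ('v set \<times> nat) set" where
  "demands E q = Sigma E (\<lambda>e. {..<q e})"

text \<open>
  A \<open>q\<close>-SDR as a choice function on demands, with one demand \<open>(e, i)\<close> for each \<open>i < q e\<close>.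
\<close>

definition solvable ::
  "'v set set \<Rightarrow> 'r set \<Rightarrow> ('r \<Rightarrow> 'v set) \<Rightarrow> ('v, 'r) token set \<Rightarrow> ('v set \<Rightarrow> nat) \<Rightarrow> bool" where
  "solvable E U T P q \<longleftrightarrow>
     (\<exists>c. (\<forall>d\<in>demands E q. c d \<in> hyperedges U T P (fst d)) \<and>
          pairwise (\<lambda>d d'. disjnt (c d) (c d')) (demands E q))"

lemma solvable_mono:
  assumes "solvable E U T P' q" and "P' \<subseteq> P"
  shows "solvable E U T P q"
proof -
  have "hyperedges U T P' e \<subseteq> hyperedges U T P e" for e
    using assms(2) unfolding hyperedges_def by blast
  then show ?thesis using assms(1) unfolding solvable_def by blast
qed

lemma solvable_without_tokens:
  assumes arr: "arrangement E U T {}" and ample: "ample E U T {} q"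
  shows "solvable E U T {} q"
proof -
  have fin: "finite E" "finite U" using arr unfolding arrangement_def by auto
  define N where "N d = {x \<in> U. fst d \<subseteq> T x}" for d :: "'a set \<times> nat"
  have "\<exists>g. inj_on g (demands E q) \<and> (\<forall>d\<in>demands E q. g d \<in> N d)"
  proof (rule marriage)
    show "finite (demands E q)" unfolding demands_def using fin by auto
    show "finite (N d)" for d unfolding N_def using fin by auto
    fix D assume D: "D \<subseteq> demands E q"
    have fE: "fst ` D \<subseteq> E" using D unfolding demands_def by auto
    have finF: "finite (fst ` D)" using fE fin finite_subset by blast
    have "D \<subseteq> demands (fst ` D) q" using D unfolding demands_def by force
    then have "card D \<le> card (demands (fst ` D) q)"
      by (rule card_mono[rotated]) (use finF in \<open>auto simp: demands_def\<close>)
    also have "\<dots> = sum q (fst ` D)" unfolding demands_def using finF by simp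
    also have "\<dots> \<le> card (\<Union>(N ` D))"
      by (rule ampleD[OF ample fE]) (auto simp: N_def covers_loops_def)
    finally show "card D \<le> card (\<Union>(N ` D))" .
  qed
  then obtain g where g: "inj_on g (demands E q)" "\<And>d. d \<in> demands E q \<Longrightarrow> g d \<in> N d"
    by blast
  have "{g d} \<in> hyperedges U T {} (fst d)" if "d \<in> demands E q" for d
    using g(2)[OF that] unfolding N_def hyperedges_def by auto
  moreover have "pairwise (\<lambda>d d'. disjnt {g d} {g d'}) (demands E q)"
    using g(1) unfolding pairwise_def by (auto dest: inj_onD)
  ultimately show ?thesis unfolding solvable_def by (intro exI[of _ "\<lambda>d. {g d}"]) auto
qed

section \<open>Contracting a token\<close>

text \<open>
  A resource of a critical token has no loop at the edge \<open>{t, u}\<close> of the token, since a loop would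
  force it into the witness that misses the token.  Hence \<open>{t, u}\<close> is not contained in either support,
  and a colouring that changes along \<open>{t, u}\<close> only is constant on both, with different values.  So
  \<open>{t, u}\<close> is the only edge between the two supports, and the loops of the contracted resource are
  those of \<open>x\<close>, those of \<open>y\<close> and one at \<open>{t, u}\<close>.
\<close>

lemma critical_token_separates:
  assumes flip: "flippable E" and arr: "arrangement E U T P" and ample: "ample E U T P q"
    and h: "(t, u, x, y) \<in> P" and crit: "\<not> ample E U T (P - {(t, u, x, y)}) q"
  shows "u \<notin> T x" "t \<notin> T y" "x \<noteq> y"
    and "\<And>e. e \<in> E \<Longrightarrow> e \<subseteq> T x \<union> T y \<Longrightarrow> e \<subseteq> T x \<or> e \<subseteq> T y \<or> e = {t, u}"
proof -
  note tok = arrangement_token[OF arr h]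
  obtain F C where FC: "covers_loops U T F C" "{t, u} \<in> F" "x \<notin> C" "y \<notin> C"
    using critical_token[OF ample crit] by metis
  show u: "u \<notin> T x" and t: "t \<notin> T y"
    using FC tok unfolding covers_loops_def by (metis empty_subsetI insert_subset)+
  then show "x \<noteq> y" using tok by auto
  obtain \<sigma> :: "'a \<Rightarrow> bool" where \<sigma>: "\<And>a b. {a, b} \<in> E \<Longrightarrow> \<sigma> a = \<sigma> b \<longleftrightarrow> {a, b} \<notin> {{t, u}}"
    using flippableE[OF flip, of "{{t, u}}"] by blast
  have tu: "\<sigma> t \<noteq> \<sigma> u" using \<sigma>[OF tok(1)] by simp
  have 1: "\<sigma> v = \<sigma> t" if "v \<in> T x" for v
  proof (rule tiedD[where f = \<sigma> and S = "T x" and E = E])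
    show "tied E (T x)" using arr tok(2) unfolding arrangement_def by auto
    show "\<sigma> a = \<sigma> b" if "a \<in> T x" "b \<in> T x" "{a, b} \<in> E" for a b
      using \<sigma>[OF that(3)] that(1,2) u by (auto simp: doubleton_eq_iff)
  qed (use that tok in auto)
  have 2: "\<sigma> v = \<sigma> u" if "v \<in> T y" for v
  proof (rule tiedD[where f = \<sigma> and S = "T y" and E = E])
    show "tied E (T y)" using arr tok(3) unfolding arrangement_def by auto
    show "\<sigma> a = \<sigma> b" if "a \<in> T y" "b \<in> T y" "{a, b} \<in> E" for a b
      using \<sigma>[OF that(3)] that(1,2) t by (auto simp: doubleton_eq_iff)
  qed (use that tok in auto)
  show "e \<subseteq> T x \<or> e \<subseteq> T y \<or> e = {t, u}" if e: "e \<in> E" "e \<subseteq> T x \<union> T y" for e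
  proof (cases "e = {t, u}")
    case False
    obtain a b where ab: "e = {a, b}"
      using arr e(1) unfolding arrangement_def by (meson card_2_iff)
    then have "\<sigma> a = \<sigma> b" using \<sigma>[of a b] e(1) False by auto
    then show ?thesis using 1[of a] 1[of b] 2[of a] 2[of b] tu e(2) unfolding ab by auto
  qed simp
qed

lemma merge_arrangement:
  assumes arr: "arrangement E U T P" and h: "(t, u, x, y) \<in> P" and "P' \<subseteq> P"
    and disj: "\<And>t' u' x' y'. (t', u', x', y') \<in> P' \<Longrightarrow> {x, y} \<inter> {x', y'} = {}"
  shows "arrangement E (U - {y}) (T(x := T x \<union> T y)) P'"
proof -
  note tok = arrangement_token[OF arr h]
  have "tied E (T x)" "tied E (T y)" using arr tok unfolding arrangement_def by auto
  then have "tied E (T x \<union> T y)" using tok by (intro tied_union)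
  moreover have "{t', u'} \<in> E \<and> x' \<in> U - {y} \<and> y' \<in> U - {y} \<and>
      t' \<in> (T(x := T x \<union> T y)) x' \<and> u' \<in> (T(x := T x \<union> T y)) y'"
    if "(t', u', x', y') \<in> P'" for t' u' x' y'
    using disj[OF that] arrangement_token[OF arr, of t' u' x' y'] that \<open>P' \<subseteq> P\<close> by auto
  ultimately show ?thesis
    using arr \<open>P' \<subseteq> P\<close> unfolding arrangement_def by (auto intro: finite_subset)
qed

text \<open>
  Suppose that a cover \<open>C\<close> of \<open>F\<close> in the contracted family is too small.  If \<open>F\<close> has an edge in at
  most one of the two original supports, then one of the two resources alone does the work of the
  contracted one: \<open>C\<close>, with \<open>y\<close> in place of \<open>x\<close> if necessary, is a cover of \<open>F\<close> in the original family.
  Otherwise \<open>x \<in> C\<close>, and \<open>insert y C\<close> is an original cover of \<open>F\<close> that may just reach \<open>sum q F\<close>.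
  Together with the witness that the token is critical the total is still too small, and as
  \<open>insert y C\<close> contains both resources of the token, uncrossing the two leaves no defect: two covers
  result, at least one of which is too small.
\<close>

lemma merge_ample:
  assumes flip: "flippable E" and arr: "arrangement E U T P" and ample: "ample E U T P q"
    and h: "(t, u, x, y) \<in> P" and crit: "\<not> ample E U T (P - {(t, u, x, y)}) q"
    and disj: "\<And>t' u' x' y'. (t', u', x', y') \<in> P - {(t, u, x, y)} \<Longrightarrow> {x, y} \<inter> {x', y'} = {}"
  shows "ample E (U - {y}) (T(x := T x \<union> T y)) (P - {(t, u, x, y)}) q"
  unfolding ample_def
proof (intro allI impI, rule ccontr)
  fix F C
  let ?T = "T(x := T x \<union> T y)"
  assume F: "F \<subseteq> E" and C: "C \<subseteq> U - {y}" and loops: "covers_loops (U - {y}) ?T F C"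
    and tokens: "\<forall>h\<in>P - {(t, u, x, y)}. covers_token F C h" and "\<not> sum q F \<le> card C"
  then have small: "card C < sum q F" by simp
  note tok = arrangement_token[OF arr h]
  note sep = critical_token_separates[OF flip arr ample h crit]
  have finC: "finite C" using C arr finite_subset unfolding arrangement_def by blast
  have xC: "x \<in> C" if "e \<in> F" "e \<subseteq> T x \<union> T y" for e
  proof -
    have "x \<in> U - {y}" "e \<subseteq> ?T x" using that tok(2) sep(3) by auto
    then show ?thesis using loops that(1) unfolding covers_loops_def by blast
  qed
  have htok: "x \<in> C" if "{t, u} \<in> F" using xC[OF that] tok(4,5) by auto
  have other: "z \<in> C" if "z \<in> U" "z \<noteq> x" "z \<noteq> y" "e \<in> F" "e \<subseteq> T z" for z e
    proof -
    have "z \<in> U - {y}" "e \<subseteq> ?T z" using that by auto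
    then show ?thesis using loops that(4) unfolding covers_loops_def by blast
  qed
  show False
  proof (cases "\<exists>e\<in>F. e \<subseteq> T y")
    case False
    have "sum q F \<le> card C"
    proof (rule ampleD[OF ample F])
      show "C \<subseteq> U" using C by blast
      show "covers_loops U T F C"
        unfolding covers_loops_def
      proof (intro ballI impI)
        fix z e assume z: "z \<in> U" "e \<in> F" "e \<subseteq> T z"
        then have "z \<noteq> y" using False by blast
        then show "z \<in> C" using other[OF z(1)] xC[of e] z by (cases "z = x") auto
      qed
      show "covers_token F C g" if "g \<in> P" for g
        using tokens that htok by (cases "g = (t, u, x, y)") auto
    qed
    then show False using small by simp
  next
    case hitsy: True
    then have x: "x \<in> C" using xC by blast
    show False
    proof (cases "\<exists>e\<in>F. e \<subseteq> T x")
      case False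
      define C' where "C' = insert y (C - {x})"
      have "sum q F \<le> card C'"
      proof (rule ampleD[OF ample F])
        show "C' \<subseteq> U" using C tok unfolding C'_def by blast
        show "covers_loops U T F C'"
          unfolding covers_loops_def
        proof (intro ballI impI)
          fix z e assume z: "z \<in> U" "e \<in> F" "e \<subseteq> T z"
          then have "z \<noteq> x" using False by blast
          then show "z \<in> C'" using other[OF z(1)] z unfolding C'_def by (cases "z = y") auto
        qed
        show "covers_token F C' g" if "g \<in> P" for g
        proof (cases "g = (t, u, x, y)")
          case True
          then show ?thesis unfolding C'_def by simp
        next
          case False
          obtain t' u' x' y' where g: "g = (t', u', x', y')" by (cases g)
          have "covers_token F C g" using tokens False that by blast
          then show ?thesis using disj[of t' u' x' y'] False that unfolding g C'_def by auto
        qed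
      qed
      moreover have "card C' \<le> card C"
      proof -
        have "card C' \<le> Suc (card (C - {x}))"
          unfolding C'_def using finC by (simp add: card_insert_if)
        also have "\<dots> = card C" by (rule card_Suc_Diff1[OF finC x])
        finally show ?thesis .
      qed
      ultimately show False using small by simp
    next
      case hitsx: True
      define C' where "C' = insert y C"
      have C'U: "C' \<subseteq> U" using C tok unfolding C'_def by blast
      have C'loops: "covers_loops U T F C'"
        unfolding covers_loops_def
      proof (intro ballI impI)
        fix z e assume z: "z \<in> U" "e \<in> F" "e \<subseteq> T z"
        then show "z \<in> C'" using other[OF z(1)] x z unfolding C'_def by auto
      qed
      have C'tokens: "covers_token F C' g" if "g \<in> P" "g \<noteq> (t, u, x, y)" for g
      proof -
        have "covers_token F C g" using tokens that by blast
        then show ?thesis unfolding C'_def by (cases g) auto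
      qed
      have C'card: "card C' \<le> sum q F"
        using small card_insert_le_m1[of "Suc (card C)" C y] unfolding C'_def by simp
      obtain F2 C2 where 2: "F2 \<subseteq> E" "C2 \<subseteq> U" "covers_loops U T F2 C2" "card C2 < sum q F2"
        "\<And>g. g \<in> P \<Longrightarrow> g \<noteq> (t, u, x, y) \<Longrightarrow> covers_token F2 C2 g"
        using critical_token[OF ample crit] by metis
      obtain F' D where *: "\<And>b. F' b \<subseteq> E" "\<And>b. D b \<subseteq> U" "\<And>b. covers_loops U T (F' b) (D b)"
        "\<And>b. sum q (F' b) + sum q (F' (\<not> b)) = sum q F + sum q F2"
        "\<And>b. card (D b) + card (D (\<not> b)) = card C' + card C2"
        "\<And>g b. g \<in> P \<Longrightarrow> covers_token F C' g \<Longrightarrow> covers_token F2 C2 g \<Longrightarrow>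
              covers_token (F' b) (D b) g"
        "\<And>t u x y b. (t, u, x, y) \<in> P \<Longrightarrow> x \<in> C' \<Longrightarrow> y \<in> C' \<Longrightarrow>
          covers_token (F' b) (D b) (t, u, x, y)"
        by (rule uncross[OF flip arr F 2(1) C'U 2(2) C'loops 2(3), of q]) blast
      have "sum q (F' b) \<le> card (D b)" for b
      proof (rule ampleD[OF ample *(1-3)])
        show "covers_token (F' b) (D b) g" if "g \<in> P" for g
        proof (cases "g = (t, u, x, y)")
          case True
          then show ?thesis using *(7)[OF h, of b] x unfolding C'_def by simp
        next
          case False
          then show ?thesis using *(6)[OF that] C'tokens[OF that] 2(5)[OF that] by blast
        qed
      qed
      from this[of True] this[of False] show False
        using *(4,5)[of True] C'card 2(4) by simp
    qed
  qed
qed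

text \<open>
  A demand served by the contracted resource is served by \<open>x\<close> alone, by \<open>y\<close> alone or by the token,
  according to where its edge lies; nothing else uses \<open>x\<close> or \<open>y\<close>.
\<close>

lemma merge_solvable:
  assumes arr: "arrangement E U T P" and h: "(t, u, x, y) \<in> P" 
    and sep: "\<And>e. e \<in> E \<Longrightarrow> e \<subseteq> T x \<union> T y \<Longrightarrow> e \<subseteq> T x \<or> e \<subseteq> T y \<or> e = {t, u}"
    and disj: "\<And>t' u' x' y'. (t', u', x', y') \<in> P - {(t, u, x, y)} \<Longrightarrow> {x, y} \<inter> {x', y'} = {}"
    and sol: "solvable E (U - {y}) (T(x := T x \<union> T y)) (P - {(t, u, x, y)}) q"
  shows "solvable E U T P q"
proof -
  let ?T = "T(x := T x \<union> T y)" and ?P = "P - {(t, u, x, y)}" and ?U = "U - {y}"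
  note tok = arrangement_token[OF arr h]
  obtain c where c: "\<And>d. d \<in> demands E q \<Longrightarrow> c d \<in> hyperedges ?U ?T ?P (fst d)"
    "pairwise (\<lambda>d d'. disjnt (c d) (c d')) (demands E q)"
    using sol unfolding solvable_def by blast
  define c' where "c' d = (if c d = {x} then if fst d \<subseteq> T x then {x}
      else if fst d \<subseteq> T y then {y} else {x, y} else c d)" for d
  have shape: "(\<exists>z. c d = {z} \<and> z \<in> ?U \<and> fst d \<subseteq> ?T z) \<or>
      (\<exists>x' y' t' u'. c d = {x', y'} \<and> (t', u', x', y') \<in> ?P \<and> {t', u'} = fst d \<and>
         x \<noteq> x' \<and> x \<noteq> y' \<and> y \<noteq> x' \<and> y \<noteq> y')"
    if "d \<in> demands E q" for d
  proof -
    from c(1)[OF that] consider z where "c d = {z}" "z \<in> ?U" "fst d \<subseteq> ?T z"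
      | x' y' t' u' where "c d = {x', y'}" "(t', u', x', y') \<in> ?P" "{t', u'} = fst d"
      unfolding hyperedges_def by blast
    then show ?thesis
    proof cases
      case 1
      then show ?thesis by blast
    next
      case 2
      then show ?thesis using disj[OF 2(2)] by blast
    qed
  qed
  have y: "y \<notin> c d" and x: "x \<in> c d \<Longrightarrow> c d = {x}" if "d \<in> demands E q" for d
    using shape[OF that] by auto
  have "c' d \<in> hyperedges U T P (fst d)" if d: "d \<in> demands E q" for d
  proof (cases "c d = {x}")
    case True
    have E: "fst d \<in> E" using d unfolding demands_def by auto
    have "fst d \<subseteq> T x \<union> T y" using shape[OF d] True by auto
    then consider "fst d \<subseteq> T x" | "\<not> fst d \<subseteq> T x" "fst d \<subseteq> T y"
      | "\<not> fst d \<subseteq> T x" "\<not> fst d \<subseteq> T y" "fst d = {t, u}"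
      using sep[OF E] by blast
    then show ?thesis
    proof cases
      case 1
      then show ?thesis using True tok unfolding c'_def hyperedges_def by auto
    next
      case 2
      then show ?thesis using True tok unfolding c'_def hyperedges_def by auto
    next
      case 3
      then have "c' d = {x, y}" unfolding c'_def using True by (simp only: if_False if_True simp_thms)
      then show ?thesis using 3(3) h unfolding hyperedges_def by blast
    qed
  next
    case False
    then have "x \<notin> c d" using x[OF d] by blast
    with shape[OF d] consider z where "c d = {z}" "z \<in> U" "fst d \<subseteq> T z"
      | x' y' t' u' where "c d = {x', y'}" "(t', u', x', y') \<in> P" "{t', u'} = fst d"
      by (metis Diff_iff fun_upd_other insertI1)
    then have "c d \<in> hyperedges U T P (fst d)"
      unfolding hyperedges_def by cases blast+
    then show ?thesis using False unfolding c'_def by simp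
  qed
  moreover have "pairwise (\<lambda>d d'. disjnt (c' d) (c' d')) (demands E q)"
  proof (rule pairwiseI)
    fix d d' assume d: "d \<in> demands E q" "d' \<in> demands E q" "d \<noteq> d'"
    have "disjnt (c d) (c d')" using c(2) d unfolding pairwise_def by blast
    then show "disjnt (c' d) (c' d')"
      using y[OF d(1)] y[OF d(2)] unfolding c'_def disjnt_def by auto
  qed
  ultimately show ?thesis unfolding solvable_def by blast
qed

lemma ample_solvable:
  assumes flip: "flippable E" and "arrangement E U T P" and "ample E U T P q"
  shows "solvable E U T P q"
  using assms(2,3)
proof (induction "card P" arbitrary: P U T rule: less_induct)
  case less
  have finP: "finite P" using less.prems unfolding arrangement_def by auto
  show ?case
  proof (cases "P = {}")
    case True
    show ?thesis using solvable_without_tokens less.prems unfolding True .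
  next
    case False
    show ?thesis
    proof (cases "\<exists>h\<in>P. ample E U T (P - {h}) q")
      case True
      then obtain h where h: "h \<in> P" "ample E U T (P - {h}) q" by blast
      have "arrangement E U T (P - {h})" by (rule arrangement_subset[OF less.prems(1)]) blast
      then have "solvable E U T (P - {h}) q"
        by (intro less.hyps[OF card_Diff1_less[OF finP h(1)]] h(2))
      then show ?thesis by (rule solvable_mono) blast
    next
      case crit: False
      obtain t u x y where h: "(t, u, x, y) \<in> P" using False by auto
      have disj: "{x, y} \<inter> {x', y'} = {}" if "(t', u', x', y') \<in> P - {(t, u, x, y)}" for t' u' x' y'
      proof (rule critical_tokens_disjoint[OF flip less.prems h refl _ _ refl])
        show "\<not> ample E U T (P - {(t, u, x, y)}) q" using crit h by blast
        show "(t', u', x', y') \<in> P" using that by blast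
        then show "\<not> ample E U T (P - {(t', u', x', y')}) q" using crit by blast
        show "(t, u, x, y) \<noteq> (t', u', x', y')" using that by blast
      qed
      have crith: "\<not> ample E U T (P - {(t, u, x, y)}) q" using crit h by blast
      have "solvable E (U - {y}) (T(x := T x \<union> T y)) (P - {(t, u, x, y)}) q"
      proof (rule less.hyps)
        show "card (P - {(t, u, x, y)}) < card P" using card_Diff1_less[OF finP h] .
        show "arrangement E (U - {y}) (T(x := T x \<union> T y)) (P - {(t, u, x, y)})"
          by (rule merge_arrangement[OF less.prems(1) h Diff_subset disj])
        show "ample E (U - {y}) (T(x := T x \<union> T y)) (P - {(t, u, x, y)}) q"
          by (rule merge_ample[OF flip less.prems h crith disj])
      qed
      then show ?thesis
        by (rule merge_solvable[OF less.prems(1) h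
              critical_token_separates(4)[OF flip less.prems h crith] disj, rotated -1])
    qed
  qed
qed


section \<open>Forests\<close>

lemma finite_matchings: "finite H \<Longrightarrow> finite {M. matching H M}"
  unfolding matching_def by (rule finite_subset[of _ "Pow H"]) auto

lemma card_le_matching_number:
  assumes "finite H" and "matching H M"
  shows "card M \<le> matching_number H"
  unfolding matching_number_def using finite_matchings[OF assms(1)] assms(2) by (intro Max_ge) auto

lemma matching_number_le_cover:
  assumes "finite H" and "finite C" and "\<And>h. h \<in> H \<Longrightarrow> h \<inter> C \<noteq> {}"
  shows "matching_number H \<le> card C"
  unfolding matching_number_def
proof (rule Max.boundedI)
  show "finite (card ` {M. matching H M})" using finite_matchings[OF assms(1)] by simp
  have "matching H {}" unfolding matching_def by simp
  then show "card ` {M. matching H M} \<noteq> {}" by blast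
  fix n assume "n \<in> card ` {M. matching H M}"
  then obtain M where M: "n = card M" "M \<subseteq> H" "disjoint M" unfolding matching_def by auto
  define pick where "pick h = (SOME x. x \<in> h \<inter> C)" for h
  have pick: "pick h \<in> h \<inter> C" if "h \<in> M" for h
    using assms(3)[of h] that M(2) unfolding pick_def by (metis ex_in_conv someI_ex subsetD)
  have "inj_on pick M"
  proof (rule inj_onI, rule ccontr)
    fix h k assume hk: "h \<in> M" "k \<in> M" "pick h = pick k" "h \<noteq> k"
    then have "disjnt h k" using M(3) unfolding pairwise_def by blast
    then show False using pick[OF hk(1)] pick[OF hk(2)] hk(3) unfolding disjnt_def by auto
  qed
  moreover have "pick ` M \<subseteq> C" using pick by blast
  ultimately show "n \<le> card C" unfolding M(1) using assms(2) by (rule card_inj_on_le)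
qed

lemma forest_has_q_SDR:
  assumes graph: "simple_graph V E" and "forest V E" and sys: "graph_system V E U Q A"
    and hall: "\<And>F. F \<subseteq> E \<Longrightarrow> sum q F \<le> matching_number (\<Union>e\<in>F. A e)"
  shows "has_q_SDR E A q"
proof -
  define T where "T x = fst (Q x)" for x
  define P where "P = {(t, u, x, y). {t, u} \<in> E \<and> x \<in> U \<and> y \<in> U \<and> t \<in> T x \<and> u \<in> T y \<and>
    {x, y} \<in> A {t, u}}"
  have finV: "finite V" and EV: "\<And>e. e \<in> E \<Longrightarrow> e \<subseteq> V \<and> card e = 2"
    using graph unfolding simple_graph_def by auto
  have finE: "finite E" by (rule finite_subset[of _ "Pow V"]) (use EV finV in auto)
  have finU: "finite U" and supp: "\<And>x. x \<in> U \<Longrightarrow> subgraph (fst (Q x)) (snd (Q x)) V E \<and>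
      connected_graph (fst (Q x)) (snd (Q x))"
    using sys unfolding graph_system_def by blast+
  have sysE: "(\<forall>h\<in>A {t, u}. h \<subseteq> U) \<and>
      {h\<in>A {t, u}. is_singleton h} = (\<lambda>x. {x}) ` (present U Q t \<inter> present U Q u) \<and>
      (\<forall>h\<in>A {t, u}. \<not> is_singleton h \<longrightarrow>
         (\<exists>x y. x \<in> present U Q t \<and> y \<in> present U Q u \<and> x \<noteq> y \<and> h = {x, y}))"
    if "{t, u} \<in> E" for t u
    using sys that unfolding graph_system_def by simp
  have AU: "h \<subseteq> U" if "{t, u} \<in> E" "h \<in> A {t, u}" for t u h
    using sysE[OF that(1)] that(2) by simp
  have Aloop: "{x} \<in> A {t, u} \<longleftrightarrow> x \<in> U \<and> {t, u} \<subseteq> T x" if "{t, u} \<in> E" for t u x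
  proof -
    have "{x} \<in> A {t, u} \<longleftrightarrow> {x} \<in> {h\<in>A {t, u}. is_singleton h}" by simp
    also have "\<dots> \<longleftrightarrow> x \<in> present U Q t \<inter> present U Q u"
      using sysE[OF that] by auto
    finally show ?thesis unfolding present_def T_def by auto
  qed
  have Apair: "\<exists>x y. x \<in> U \<and> y \<in> U \<and> t \<in> T x \<and> u \<in> T y \<and> k = {x, y}"
    if "{t, u} \<in> E" "k \<in> A {t, u}" "\<not> is_singleton k" for t u k
  proof -
    have "\<exists>x y. x \<in> present U Q t \<and> y \<in> present U Q u \<and> k = {x, y}"
      using sysE[OF that(1)] that(2,3) by blast
    then show ?thesis unfolding present_def T_def by blast
  qed
  have edge: "\<exists>t u. e = {t, u}" if "e \<in> E" for e
    using EV[OF that] by (meson card_2_iff)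
  have arr: "arrangement E U T P"
    unfolding arrangement_def
  proof (intro conjI)
    have TV: "T x \<subseteq> V" if "x \<in> U" for x
      using supp[OF that] unfolding T_def subgraph_def by blast
    have "P \<subseteq> V \<times> V \<times> U \<times> U" unfolding P_def using TV by blast
    then show "finite P" by (rule finite_subset) (use finV finU in simp)
    show "\<forall>x\<in>U. tied E (T x)"
    proof
      fix x assume "x \<in> U"
      then have "connected_graph (T x) (snd (Q x))" "snd (Q x) \<subseteq> E"
        using supp unfolding T_def subgraph_def by simp_all
      then show "tied E (T x)" by (rule connected_graph_tied)
    qed
  qed (use finE finU EV in \<open>auto simp: P_def\<close>)
  have "ample E U T P q"
    unfolding ample_def
  proof (intro allI impI)
    fix F C assume F: "F \<subseteq> E" and C: "C \<subseteq> U" and loops: "covers_loops U T F C"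
      and tokens: "\<forall>h\<in>P. covers_token F C h"
    have "sum q F \<le> matching_number (\<Union>e\<in>F. A e)" by (rule hall[OF F])
    also have "\<dots> \<le> card C"
    proof (rule matching_number_le_cover)
      have "(\<Union>e\<in>F. A e) \<subseteq> Pow U" using AU edge F by blast
      then show "finite (\<Union>e\<in>F. A e)" by (rule finite_subset) (use finU in simp)
      show "finite C" using C finU by (rule finite_subset)
      fix h assume "h \<in> (\<Union>e\<in>F. A e)"
      then obtain t u where tu: "{t, u} \<in> F" "h \<in> A {t, u}" using edge F by blast
      then have E: "{t, u} \<in> E" using F by blast
      show "h \<inter> C \<noteq> {}"
      proof (cases "is_singleton h")
        case True
        then obtain x where x: "h = {x}" by (rule is_singletonE)
        then have "x \<in> U" "{t, u} \<subseteq> T x" using Aloop[OF E, of x] tu(2) by simp_all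
        then have "x \<in> C" using loops tu(1) unfolding covers_loops_def by blast
        then show ?thesis using x by blast
      next
        case False
        then obtain x y where xy: "x \<in> U" "y \<in> U" "t \<in> T x" "u \<in> T y" "h = {x, y}"
          using Apair[OF E tu(2) False] by blast
        then have "(t, u, x, y) \<in> P" unfolding P_def using E tu(2) by blast
        then have "covers_token F C (t, u, x, y)" using tokens by blast
        then show ?thesis using tu(1) xy(5) by auto
      qed
    qed
    finally show "sum q F \<le> card C" .
  qed
  then have "solvable E U T P q"
    by (rule ample_solvable[OF forest_flippable[OF graph assms(2)] arr])
  then obtain c where c: "\<And>d. d \<in> demands E q \<Longrightarrow> c d \<in> hyperedges U T P (fst d)"
    "pairwise (\<lambda>d d'. disjnt (c d) (c d')) (demands E q)"
    unfolding solvable_def by blast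
  have loop: "{x} \<in> A e" if "e \<in> E" "x \<in> U" "e \<subseteq> T x" for e x
  proof -
    have "\<exists>t u. e = {t, u}" using edge[OF that(1)] .
    then show ?thesis using Aloop that by blast
  qed
  have sub: "hyperedges U T P e \<subseteq> A e" if "e \<in> E" for e
    using loop[OF that] unfolding hyperedges_def P_def by blast
  have ne: "h \<noteq> {}" if "h \<in> hyperedges U T P e" for h e
    using that unfolding hyperedges_def by blast
  define S where "S e = (\<lambda>i. c (e, i)) ` {..<q e}" for e
  have dem: "(e, i) \<in> demands E q" if "e \<in> E" "i < q e" for e i
    using that unfolding demands_def by simp
  have apart: "disjnt (c d) (c d')" if "d \<in> demands E q" "d' \<in> demands E q" "d \<noteq> d'" for d d'
    using c(2) that unfolding pairwise_def by blast
  have "is_q_SDR E A q S"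
    unfolding is_q_SDR_def
  proof (intro conjI ballI)
    fix e assume e: "e \<in> E"
    show "S e \<subseteq> A e" unfolding S_def using c(1)[OF dem[OF e]] sub[OF e] by auto
    have "inj_on (\<lambda>i. c (e, i)) {..<q e}"
    proof (rule inj_onI, rule ccontr)
      fix i j assume "i \<in> {..<q e}" "j \<in> {..<q e}" and eq: "c (e, i) = c (e, j)" and "i \<noteq> j"
      then have "disjnt (c (e, i)) (c (e, j))" using dem[OF e] by (intro apart) auto
      moreover have "c (e, i) \<noteq> {}" using ne[OF c(1)[OF dem[OF e]]] \<open>i \<in> {..<q e}\<close> by simp
      ultimately show False unfolding eq disjnt_def by simp
    qed
    then show "card (S e) = q e" unfolding S_def by (simp add: card_image)
  next
    show "pairwise (\<lambda>(e, h) (f, k). disjnt h k) (Sigma E S)"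
    proof (rule pairwiseI)
      fix z z' assume z: "z \<in> Sigma E S" "z' \<in> Sigma E S" "z \<noteq> z'"
      obtain e i where ei: "z = (e, c (e, i))" "e \<in> E" "i < q e" using z(1) unfolding S_def by auto
      obtain f j where fj: "z' = (f, c (f, j))" "f \<in> E" "j < q f" using z(2) unfolding S_def by auto
      have "(e, i) \<noteq> (f, j)" using z(3) ei(1) fj(1) by auto
      then have "disjnt (c (e, i)) (c (f, j))" using dem ei(2,3) fj(2,3) by (intro apart) auto
      then show "(\<lambda>(e, h) (f, k). disjnt h k) z z'" unfolding ei(1) fj(1) by simp
    qed
  qed
  then show ?thesis unfolding has_q_SDR_def by blast
qed


section \<open>Cycles\<close>

lemma path_connected_graph:
  assumes "xs \<noteq> []" and "successively (\<lambda>a b. {a, b} \<in> E) xs"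
  shows "connected_graph (set xs) {e \<in> E. e \<subseteq> set xs}"
proof -
  define R where "R a b \<longleftrightarrow> {a, b} \<in> E \<and> a \<in> set xs \<and> b \<in> set xs" for a b
  have "successively R xs"
    using assms(2) by (rule successively_mono) (simp add: R_def)
  then have from_hd: "R\<^sup>*\<^sup>* (hd xs) v" if "v \<in> set xs" for v
    using that
  proof (induction xs rule: induct_list012)
    case (3 x y zs)
    then show ?case by (cases "v = x") (auto intro: converse_rtranclp_into_rtranclp)
  qed auto
  have "symp R" unfolding R_def by (auto intro!: sympI simp: insert_commute)
  then have to_hd: "R\<^sup>*\<^sup>* v (hd xs)" if "v \<in> set xs" for v
    using from_hd[OF that] by (metis sympD symp_rtranclp)
  show ?thesis
    unfolding connected_graph_def
  proof (intro conjI ballI)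
    show "set xs \<noteq> {}" using assms(1) by simp
    fix u v assume uv: "u \<in> set xs" "v \<in> set xs"
    then have "R\<^sup>*\<^sup>* u v" using to_hd from_hd by (meson rtranclp_trans)
    then have "\<exists>p. p \<noteq> [] \<and> distinct p \<and> set p \<subseteq> set xs \<and> successively R p \<and> hd p = u \<and> last p = v"
      by (rule rtranclp_distinct_path) (use uv in \<open>auto simp: R_def\<close>)
    then obtain p where p: "p \<noteq> []" "set p \<subseteq> set xs" "successively R p" "hd p = u" "last p = v"
      by blast
    have "successively (\<lambda>a b. {a, b} \<in> {e \<in> E. e \<subseteq> set xs}) p"
      using p(3) by (rule successively_mono) (simp add: R_def)
    then show "\<exists>p. walk (set xs) {e \<in> E. e \<subseteq> set xs} p \<and> hd p = u \<and> last p = v"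
      using p unfolding walk_def by blast
  qed
qed

lemma finite_inj_into_infinite:
  assumes "infinite (UNIV :: 'b set)" and "finite B"
  obtains g :: "'a \<Rightarrow> 'b" where "inj_on g B"
proof -
  obtain X :: "'b set" where X: "finite X" "card X = card B"
    using infinite_arbitrarily_large[OF assms(1), of "card B"] by blast
  then obtain g where "bij_betw g B X" using finite_same_card_bij[OF assms(2) X(1)] by auto
  then show thesis using that bij_betw_def by blast
qed

text \<open>
  The cycle is viewed as a triangle \<open>v0\<close>, \<open>v1\<close>, \<open>R\<close> whose third corner is the path on the remaining
  vertices, with the sides \<open>a\<close>, \<open>b\<close>, \<open>c\<close>.  The resources \<open>x\<close>, \<open>y\<close>, \<open>z\<close>, \<open>s0\<close>, \<open>s1\<close> have the supports
  \<open>R + v0\<close>, \<open>R + v1\<close>, \<open>R\<close>, \<open>v0\<close>, \<open>v1\<close>.  The hyperedges are \<open>{x, y}\<close> for \<open>a\<close>, then \<open>{y}\<close> and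
  \<open>{z, s1}\<close> for \<open>b\<close>, and \<open>{x}\<close> and \<open>{z, s0}\<close> for \<open>c\<close>.  Any two sides can be served disjointly, and for
  all three the matching \<open>{y}\<close>, \<open>{x}\<close>, \<open>{z, s1}\<close> is large enough, although it contains nothing for \<open>a\<close>.
  Supports may span further edges of the graph and so get loops there; this is harmless,
  because every edge other than the three sides is served by a private resource.
\<close>

lemma cycle_obstruction:
  fixes V :: "'v set" and E :: "'v set set"
  assumes graph: "simple_graph V E" and inf: "infinite (UNIV :: 'r set)"
    and cycle: "graph_cycle V E p"
  obtains U :: "'r set" and Q :: "'r \<Rightarrow> 'v set \<times> 'v set set" and A :: "'v set \<Rightarrow> 'r set set"
  where "graph_system V E U Q A"
    and "\<And>F. F \<subseteq> E \<Longrightarrow> card F \<le> matching_number (\<Union>e\<in>F. A e)"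
    and "\<not> has_q_SDR E A (\<lambda>_. 1)"
proof -
  have finV: "finite V" and EV: "\<And>e. e \<in> E \<Longrightarrow> e \<subseteq> V \<and> card e = 2"
    using graph unfolding simple_graph_def by auto
  have finE: "finite E" by (rule finite_subset[of _ "Pow V"]) (use EV finV in auto)
  obtain v0 v1 rest where p: "p = v0 # v1 # rest" "rest \<noteq> []"
    using cycle unfolding graph_cycle_def by (cases p; cases "tl p"; cases "tl (tl p)") auto
  define R where "R = set rest"
  define a where "a = {v0, v1}"
  define b where "b = {v1, hd rest}"
  define c where "c = {last rest, v0}"
  have cyc: "v0 \<noteq> v1" "v0 \<notin> R" "v1 \<notin> R" "insert v0 (insert v1 R) \<subseteq> V"
    "a \<in> E" "b \<in> E" "c \<in> E" "successively (\<lambda>x y. {x, y} \<in> E) rest"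
    using cycle p(2) unfolding p(1) graph_cycle_def walk_def R_def a_def b_def c_def
    by (auto simp: successively_Cons)
  have ends: "hd rest \<in> R" "last rest \<in> R" unfolding R_def using p(2) by auto
  have abc: "a \<noteq> b" "a \<noteq> c" "b \<noteq> c"
    using cyc(1-3) ends unfolding a_def b_def c_def by (auto simp: doubleton_eq_iff)
  define E' where "E' = E - {a, b, c}"
  have "finite (Inl ` E' \<union> Inr ` {..<5::nat})" unfolding E'_def using finE by simp
  then obtain g :: "'v set + nat \<Rightarrow> 'r" where g: "inj_on g (Inl ` E' \<union> Inr ` {..<5::nat})"
    by (rule finite_inj_into_infinite[OF inf])
  have geq: "g i = g j \<longleftrightarrow> i = j"
    if "i \<in> Inl ` E' \<union> Inr ` {..<5}" "j \<in> Inl ` E' \<union> Inr ` {..<5}" for i j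
    by (rule inj_on_eq_iff[OF g that])
  define f where "f e = g (Inl e)" for e
  define x where "x = g (Inr 0)"
  define y where "y = g (Inr 1)"
  define z where "z = g (Inr 2)"
  define s0 where "s0 = g (Inr 3)"
  define s1 where "s1 = g (Inr 4)"
  have f: "inj_on f E'" unfolding f_def by (rule inj_onI) (simp add: geq)
  have "distinct [x, y, z, s0, s1]"
    unfolding x_def y_def z_def s0_def s1_def by (simp add: geq)
  then have dist: "x \<noteq> y" "x \<noteq> z" "x \<noteq> s0" "x \<noteq> s1" "y \<noteq> z" "y \<noteq> s0" "y \<noteq> s1" "z \<noteq> s0" "z \<noteq> s1" "s0 \<noteq> s1"
    by simp_all
  have fnew: "f e \<noteq> x" "f e \<noteq> y" "f e \<noteq> z" "f e \<noteq> s0" "f e \<noteq> s1" if "e \<in> E'" for e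
    using that unfolding f_def x_def y_def z_def s0_def s1_def by (simp_all add: geq)
  define W where "W r = (if r = x then insert v0 R else if r = y then insert v1 R else if r = z then R
      else if r = s0 then {v0} else if r = s1 then {v1} else the_inv_into E' f r)" for r
  have W: "W x = insert v0 R" "W y = insert v1 R" "W z = R" "W s0 = {v0}" "W s1 = {v1}"
    unfolding W_def using dist by auto
  have Wf: "W (f e) = e" if "e \<in> E'" for e
    unfolding W_def using fnew[OF that] the_inv_into_f_f[OF f that] by simp
  define U where "U = {x, y, z, s0, s1} \<union> f ` E'"
  define Q where "Q r = (W r, {e \<in> E. e \<subseteq> W r})" for r
  define pairs where "pairs e = (if e = a then {{x, y}} else if e = b then {{z, s1}}
      else if e = c then {{z, s0}} else {})" for e
  define A where "A e = {{r} | r. r \<in> U \<and> e \<subseteq> W r} \<union> pairs e" for e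
  have pairsU: "h \<subseteq> {x, y, z, s0, s1}" "\<not> is_singleton h" if "h \<in> pairs e" for h e
    using that dist unfolding pairs_def by (auto split: if_splits simp: is_singleton_def doubleton_eq_iff)
  have finU: "finite U" unfolding U_def E'_def using finE by simp
  have sys: "graph_system V E U Q A"
  proof -
    have "W r \<subseteq> V \<and> connected_graph (W r) {e \<in> E. e \<subseteq> W r}" if rU: "r \<in> U" for r
    proof -
      have last: "{v0, last rest} \<in> E" using cyc(7) unfolding c_def by (simp add: insert_commute)
      have "\<exists>xs. xs \<noteq> [] \<and> successively (\<lambda>x y. {x, y} \<in> E) xs \<and> set xs = W r \<and> set xs \<subseteq> V"
      proof -
        consider "r = x" | "r = y" | "r = z" | "r = s0" | "r = s1" | e where "e \<in> E'" "r = f e"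
          using rU unfolding U_def by blast
        then show ?thesis
        proof cases
          case 1
          then show ?thesis using cyc p(2) last W
            by (intro exI[of _ "v0 # rev rest"])
              (auto simp: successively_Cons hd_rev R_def insert_commute)
        next
          case 2
          then show ?thesis using cyc p(2) W unfolding b_def
            by (intro exI[of _ "v1 # rest"]) (auto simp: successively_Cons R_def)
        next
          case 3
          then show ?thesis using cyc p(2) W by (intro exI[of _ rest]) (auto simp: R_def)
        next
          case 4
          then show ?thesis using cyc W by (intro exI[of _ "[v0]"]) auto
        next
          case 5
          then show ?thesis using cyc W by (intro exI[of _ "[v1]"]) auto
        next
          case 6
          then have e: "e \<in> E" unfolding E'_def by blast
          then obtain t u where "e = {t, u}" using EV by (meson card_2_iff)
          then show ?thesis using 6 Wf EV[OF e] e by (intro exI[of _ "[t, u]"]) auto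
        qed
      qed
      then obtain xs where "xs \<noteq> []" "successively (\<lambda>x y. {x, y} \<in> E) xs" "set xs = W r" "set xs \<subseteq> V"
        by blast
      then show ?thesis using path_connected_graph[of xs E] by simp
    qed
    moreover have "h \<subseteq> U" if "h \<in> A e" for h e
      using that pairsU(1) unfolding A_def U_def by blast
    moreover have "{h \<in> A {t, u}. is_singleton h} = (\<lambda>r. {r}) ` (present U Q t \<inter> present U Q u)" for t u
      using pairsU(2) unfolding A_def present_def Q_def by auto
    moreover have "\<exists>r r'. r \<in> present U Q t \<and> r' \<in> present U Q u \<and> r \<noteq> r' \<and> h = {r, r'}"
      if "h \<in> A {t, u}" "\<not> is_singleton h" for t u h
    proof -
      have h: "h \<in> pairs {t, u}" using that unfolding A_def by auto
      have one: "\<exists>r r'. r \<in> present U Q t \<and> r' \<in> present U Q u \<and> r \<noteq> r' \<and> h = {r, r'}"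
        if "{t, u} = {t', u'}" "h = {r, r'}" "r \<in> U" "r' \<in> U" "r \<noteq> r'" "t' \<in> W r" "u' \<in> W r'"
        for t' u' r r'
      proof (cases "t = t' \<and> u = u'")
        case True
        then show ?thesis using that unfolding present_def Q_def by auto
      next
        case False
        then have "t = u'" "u = t'" using that(1) by (auto simp: doubleton_eq_iff)
        then show ?thesis using that unfolding present_def Q_def
          by (intro exI[of _ r'] exI[of _ r]) (auto simp: insert_commute)
      qed
      consider "{t, u} = a" "h = {x, y}" | "{t, u} = b" "h = {s1, z}" | "{t, u} = c" "h = {z, s0}"
        using h unfolding pairs_def by (auto split: if_splits)
      then show ?thesis
      proof cases
        case 1
        then show ?thesis unfolding a_def using W dist one[of v0 v1 x y] by (auto simp: U_def)
      next
        case 2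
        then show ?thesis unfolding b_def using W dist ends one[of v1 "hd rest" s1 z] by (auto simp: U_def)
      next
        case 3
        then show ?thesis unfolding c_def using W dist ends one[of "last rest" v0 z s0] by (auto simp: U_def)
      qed
    qed
    ultimately show ?thesis
      using finU unfolding graph_system_def subgraph_def Q_def by auto
  qed
  have loops: "{y} \<in> A b" "{x} \<in> A c" "{x, y} \<in> A a" "{z, s1} \<in> A b" "{z, s0} \<in> A c"
    using W ends abc unfolding A_def U_def pairs_def by (auto simp: b_def c_def)
  have floops: "{f e} \<in> A e" if "e \<in> E'" for e
    using that Wf unfolding A_def U_def by blast
  have hall: "card F \<le> matching_number (\<Union>e\<in>F. A e)" if F: "F \<subseteq> E" for F
  proof -
    define M0 where "M0 = (if a \<in> F \<and> b \<in> F \<and> c \<in> F then {{y}, {x}, {z, s1}}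
      else if a \<in> F then {{x, y}} \<union> (if b \<in> F then {{z, s1}} else {}) \<union> (if c \<in> F then {{z, s0}} else {})
      else (if b \<in> F then {{y}} else {}) \<union> (if c \<in> F then {{x}} else {}))"
    have M0: "M0 \<subseteq> (\<Union>e\<in>F. A e)" "disjoint M0" "card M0 = card (F \<inter> {a, b, c})"
      "\<Union>M0 \<subseteq> {x, y, z, s0, s1}" "finite M0"
    proof -
      show "M0 \<subseteq> (\<Union>e\<in>F. A e)" unfolding M0_def using loops by auto
      show "disjoint M0"
        unfolding M0_def using dist dist[symmetric] by (auto simp: pairwise_insert)
      show "card M0 = card (F \<inter> {a, b, c})"
        unfolding M0_def using dist dist[symmetric] abc
        by (auto simp: Int_insert_right doubleton_eq_iff)
    qed (auto simp: M0_def)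
    define M1 where "M1 = (\<lambda>e. {f e}) ` (F \<inter> E')"
    have finM1: "finite M1" unfolding M1_def E'_def using finE by simp
    have cardM1: "card M1 = card (F \<inter> E')"
      unfolding M1_def by (rule card_image) (use f in \<open>auto simp: inj_on_def\<close>)
    have M1: "M1 \<subseteq> (\<Union>e\<in>F. A e)" using floops unfolding M1_def by auto
    have cross: "disjnt h k" if "h \<in> M0" "k \<in> M1" for h k
      using that M0(4) fnew unfolding M1_def disjnt_def by blast
    have "M0 \<inter> M1 = {}" using cross unfolding M1_def disjnt_def by blast
    have "disjoint (M0 \<union> M1)"
      unfolding pairwise_def
    proof (intro ballI impI)
      fix h k assume hk: "h \<in> M0 \<union> M1" "k \<in> M0 \<union> M1" "h \<noteq> k"
      have "disjnt h k" if "h \<in> M1" "k \<in> M1" using that hk(3) unfolding M1_def disjnt_def by auto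
      then show "disjnt h k"
        using hk cross M0(2) unfolding pairwise_def by (metis UnE disjnt_sym)
    qed
    then have "matching (\<Union>e\<in>F. A e) (M0 \<union> M1)" unfolding matching_def using M0(1) M1 by blast
    moreover have "(\<Union>e\<in>F. A e) \<subseteq> Pow U"
      using pairsU(1) unfolding A_def U_def by blast
    then have "finite (\<Union>e\<in>F. A e)" by (rule finite_subset) (use finU in simp)
    ultimately have "card (M0 \<union> M1) \<le> matching_number (\<Union>e\<in>F. A e)"
      by (intro card_le_matching_number)
    moreover have "card (M0 \<union> M1) = card M0 + card M1"
      using M0(5) finM1 \<open>M0 \<inter> M1 = {}\<close> by (rule card_Un_disjoint)
    moreover have "card F = card (F \<inter> {a, b, c}) + card (F \<inter> E')"
    proof -
      have "F = (F \<inter> {a, b, c}) \<union> (F \<inter> E')" using F unfolding E'_def by blast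
      moreover have "card ((F \<inter> {a, b, c}) \<union> (F \<inter> E')) = card (F \<inter> {a, b, c}) + card (F \<inter> E')"
        by (rule card_Un_disjoint) (use finE in \<open>auto simp: E'_def\<close>)
      ultimately show ?thesis by simp
    qed
    ultimately show ?thesis using M0(3) cardM1 by simp
  qed
  have "\<not> has_q_SDR E A (\<lambda>_. 1)"
  proof
    assume "has_q_SDR E A (\<lambda>_. 1)"
    then obtain S where S: "\<And>e. e \<in> E \<Longrightarrow> S e \<subseteq> A e \<and> card (S e) = 1"
      "pairwise (\<lambda>(e, h) (f, k). disjnt h k) (Sigma E S)"
      unfolding has_q_SDR_def is_q_SDR_def by auto
    have apart: "disjnt h k" if "e \<in> E" "e' \<in> E" "h \<in> S e" "k \<in> S e'" "e \<noteq> e'" for e e' h k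
      using pairwiseD[OF S(2), of "(e, h)" "(e', k)"] that by simp
    have onlyf: "e = e'" if "e \<in> {a, b, c}" "e' \<in> E'" "e \<subseteq> e'" for e e'
    proof (rule card_subset_eq[OF _ that(3)])
      show "finite e'" using EV[of e'] that(2) finV unfolding E'_def by (auto intro: finite_subset)
      show "card e = card e'" using EV that(1,2) cyc(5-7) unfolding E'_def by auto
    qed
    have noloop: "\<not> e \<subseteq> W (f e')" if "e \<in> {a, b, c}" "e' \<in> E'" for e e'
      using onlyf[OF that] Wf[OF that(2)] that unfolding E'_def by auto
    have owner: "r \<in> {x, y, z, s0, s1}" if "r \<in> U" "e \<subseteq> W r" "e \<in> {a, b, c}" for r e
      using that noloop unfolding U_def by blast
    have "\<not> a \<subseteq> W r" and "b \<subseteq> W r \<Longrightarrow> r = y" and "c \<subseteq> W r \<Longrightarrow> r = x"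
      if "r \<in> {x, y, z, s0, s1}" for r
      using that W cyc(1-3) ends by (auto simp: a_def b_def c_def)
    note loop_owner = this[OF owner]
    have Aa: "A a \<subseteq> {{x, y}}" and Ab: "A b \<subseteq> {{y}, {z, s1}}" and Ac: "A c \<subseteq> {{x}, {z, s0}}"
      using loop_owner abc unfolding A_def pairs_def by auto
    have "S e \<noteq> {}" if "e \<in> E" for e using S(1)[OF that] by auto
    then obtain ha hb hc where h: "ha \<in> S a" "hb \<in> S b" "hc \<in> S c"
      using cyc(5-7) by (meson ex_in_conv)
    have "disjnt ha hb" "disjnt ha hc" "disjnt hb hc"
      using apart[OF _ _ h(1,2)] apart[OF _ _ h(1,3)] apart[OF _ _ h(2,3)] cyc(5-7) abc by simp_all
    moreover have "ha = {x, y}" "hb \<in> {{y}, {z, s1}}" "hc \<in> {{x}, {z, s0}}"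
      using h S(1)[OF cyc(5)] S(1)[OF cyc(6)] S(1)[OF cyc(7)] Aa Ab Ac by blast+
    ultimately show False unfolding disjnt_def by auto
  qed
  with sys hall show thesis by (rule that)
qed

theorem theorem1p3:
  fixes V :: "'v set" and E :: "'v set set"
  assumes "simple_graph V E"
    and "infinite (UNIV :: 'r set)"
  shows "forest V E \<longleftrightarrow>
    (\<forall>(U :: 'r set) (Q :: 'r \<Rightarrow> 'v set \<times> 'v set set) (A :: 'v set \<Rightarrow> 'r set set)
       (q :: 'v set \<Rightarrow> nat).
       graph_system V E U Q A \<longrightarrow>
       (\<forall>e\<in>E. q e > 0) \<longrightarrow>
       (\<forall>F. F \<subseteq> E \<longrightarrow> matching_number (\<Union>e\<in>F. A e) \<ge> (\<Sum>e\<in>F. q e)) \<longrightarrow>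
       has_q_SDR E A q)"
proof (rule iffI)
  assume "forest V E"
  then show "\<forall>(U :: 'r set) (Q :: 'r \<Rightarrow> 'v set \<times> 'v set set) (A :: 'v set \<Rightarrow> 'r set set)
       (q :: 'v set \<Rightarrow> nat).
       graph_system V E U Q A \<longrightarrow>
       (\<forall>e\<in>E. q e > 0) \<longrightarrow>
       (\<forall>F. F \<subseteq> E \<longrightarrow> matching_number (\<Union>e\<in>F. A e) \<ge> (\<Sum>e\<in>F. q e)) \<longrightarrow>
       has_q_SDR E A q"
    using forest_has_q_SDR[OF assms(1)] by blast
next
  assume hall: "\<forall>(U :: 'r set) (Q :: 'r \<Rightarrow> 'v set \<times> 'v set set) (A :: 'v set \<Rightarrow> 'r set set)
       (q :: 'v set \<Rightarrow> nat).
       graph_system V E U Q A \<longrightarrow>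
       (\<forall>e\<in>E. q e > 0) \<longrightarrow>
       (\<forall>F. F \<subseteq> E \<longrightarrow> matching_number (\<Union>e\<in>F. A e) \<ge> (\<Sum>e\<in>F. q e)) \<longrightarrow>
       has_q_SDR E A q"
  show "forest V E"
  proof (rule ccontr)
    assume "\<not> forest V E"
    then obtain p where p: "graph_cycle V E p" unfolding forest_def by blast
    obtain U :: "'r set" and Q A where "graph_system V E U Q A"
      "\<And>F. F \<subseteq> E \<Longrightarrow> card F \<le> matching_number (\<Union>e\<in>F. A e)" "\<not> has_q_SDR E A (\<lambda>_. 1)"
      by (rule cycle_obstruction[OF assms p]) (rule that)
    then show False using hall[rule_format, of U Q A "\<lambda>_. 1"] by simp
  qed
qed

end
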